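(* Let $\mathfrak{A}$ be a unital $C^*$-algebra and let $x\in\mathfrak{A}$. Then the following hold. (i) $\frac12\|x\|\le \frac12\sqrt{\|x^*x+xx^*\|}\le v(x)$. (ii) $v(x)\le \frac{1}{\sqrt2}\sqrt{\|x^*x+xx^*\|}\le \|x\|$.
   Context: $\mathfrak{A}$ is a (nonzero, complex) $C^*$-algebra with unit $e$. The set of normalized states is $\mathcal{S}(\mathfrak{A})=\{\varphi\in\mathfrak{A}':\varphi(e)=\|\varphi\|=1\}$, where $\mathfrak{A}'$ is the dual space of $\mathfrak{A}$. The numerical radius of $x\in\mathfrak{A}$ is $v(x)=\sup\{|\varphi(x)|:\varphi\in\mathcal{S}(\mathfrak{A})\}$. *)

theory Defs
  imports "HOL-Analysis.Analysis"
begin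

text \<open>
  The library provides real scalars only, so complex scalar multiplication is added on top of
  the real normed algebra and is required to extend \<^term>\<open>scaleR\<close>. The class \<^class>\<open>ring_1\<close>
  contributes the unit together with \<^prop>\<open>0 \<noteq> 1\<close>, i.e. the algebra is nonzero; that the unit has
  norm one is derived below.
\<close>

class unital_cstar_algebra = real_normed_algebra + ring_1 + banach +
  fixes scaleC :: "complex \<Rightarrow> 'a \<Rightarrow> 'a" (infixr "*\<^sub>C" 75)
    and star :: "'a \<Rightarrow> 'a"
  assumes scaleC_add_right: "c *\<^sub>C (x + y) = c *\<^sub>C x + c *\<^sub>C y"
    and scaleC_add_left: "(c + d) *\<^sub>C x = c *\<^sub>C x + d *\<^sub>C x"
    and scaleC_scaleC: "c *\<^sub>C d *\<^sub>C x = (c * d) *\<^sub>C x"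
    and scaleC_of_real: "complex_of_real r *\<^sub>C x = r *\<^sub>R x"
    and mult_scaleC_left: "(c *\<^sub>C x) * y = c *\<^sub>C (x * y)"
    and mult_scaleC_right: "x * (c *\<^sub>C y) = c *\<^sub>C (x * y)"
    and norm_scaleC: "norm (c *\<^sub>C x) = cmod c * norm x"
    and star_star: "star (star x) = x"
    and star_add: "star (x + y) = star x + star y"
    and star_scaleC: "star (c *\<^sub>C x) = cnj c *\<^sub>C star x"
    and star_mult: "star (x * y) = star y * star x"
    and norm_star_mult_self: "norm (star x * x) = (norm x)\<^sup>2"
begin

lemma star_one: "star 1 = 1"
  by (metis mult_1_left mult_1_right star_mult star_star)

subclass real_normed_algebra_1
proof
  have "norm (1::'a) * norm (1::'a) = norm (1::'a) * 1"
    using norm_star_mult_self[of 1] by (simp add: star_one monoid_mult_class.power2_eq_square)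
  then show "norm (1::'a) = 1"
    by simp
qed

end

instantiation complex :: unital_cstar_algebra
begin

definition scaleC_complex :: "complex \<Rightarrow> complex \<Rightarrow> complex" where
  "scaleC_complex c z = c * z"

definition star_complex :: "complex \<Rightarrow> complex" where
  "star_complex z = cnj z"

instance
  by standard
    (simp_all add: scaleC_complex_def star_complex_def algebra_simps norm_mult scaleR_conv_of_real
      power2_eq_square)

end

text \<open>Since scalar multiplication extends the real one, the operator norm of a bounded
  complex-linear functional is the library's \<^const>\<open>onorm\<close> of the underlying real-linear map.\<close>

definition dual_space :: "('a::unital_cstar_algebra \<Rightarrow> complex) set" where
  "dual_space = {\<phi>. bounded_linear \<phi> \<and> (\<forall>c x. \<phi> (c *\<^sub>C x) = c * \<phi> x)}"

definition states :: "('a::unital_cstar_algebra \<Rightarrow> complex) set" where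
  "states = {\<phi> \<in> dual_space. \<phi> 1 = 1 \<and> onorm \<phi> = 1}"

text \<open>This is a supremum of reals over a set that is bounded (by the norm of \<open>x\<close>) and, by the
  Hahn-Banach theorem, nonempty, so it is never an unspecified value.\<close>

definition numerical_radius :: "'a::unital_cstar_algebra \<Rightarrow> real" where
  "numerical_radius x = (SUP \<phi>\<in>states. cmod (\<phi> x))"

end

theory Submission
  imports Defs
begin

text \<open>
  Write \<open>x = p + i q\<close> with \<open>p\<close>, \<open>q\<close> selfadjoint, so that \<open>x\<^sup>* x + x x\<^sup>* = 2 (p\<^sup>2 + q\<^sup>2)\<close>.
  For a state \<open>\<phi>\<close>, \<open>|\<phi> x|\<^sup>2 = (\<phi> p)\<^sup>2 + (\<phi> q)\<^sup>2 \<le> \<phi> (p\<^sup>2 + q\<^sup>2)\<close> gives the upper bound on the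
  numerical radius. States norm selfadjoint elements, so \<open>\<parallel>p\<parallel>\<close> and \<open>\<parallel>q\<parallel>\<close> are at most the
  numerical radius, which gives the lower bound. A state norming \<open>x\<^sup>* x\<close> is nonnegative at
  \<open>x x\<^sup>*\<close>, whence \<open>\<parallel>x\<parallel>\<^sup>2 \<le> \<parallel>x\<^sup>* x + x x\<^sup>*\<parallel>\<close>. Spectral theory is avoided: positivity and the
  existence of norming states come from the \<open>C\<^sup>*\<close>-identity applied to polynomials in one
  selfadjoint element.
\<close>

section \<open>Involution and Cartesian decomposition\<close>

lemma scaleC_scaleR: "c *\<^sub>C (r *\<^sub>R x) = r *\<^sub>R (c *\<^sub>C (x::'a::unital_cstar_algebra))"
  by (metis mult.commute scaleC_of_real scaleC_scaleC)

lemma scaleC_zero_right [simp]: "c *\<^sub>C (0::'a::unital_cstar_algebra) = 0"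
  by (metis add_cancel_right_left scaleC_add_right)

lemma scaleC_minus_right: "c *\<^sub>C (- x) = - (c *\<^sub>C (x::'a::unital_cstar_algebra))"
  by (metis add_eq_0_iff scaleC_add_right scaleC_zero_right)

lemma scaleC_minus_left: "(- c) *\<^sub>C x = - (c *\<^sub>C (x::'a::unital_cstar_algebra))"
  by (metis add.right_inverse add_eq_0_iff of_real_0 scaleC_add_left scaleC_of_real scale_zero_left)

lemma scaleC_one [simp]: "1 *\<^sub>C x = (x::'a::unital_cstar_algebra)"
  by (metis of_real_1 scaleC_of_real scaleR_one)

lemma star_zero [simp]: "star (0::'a::unital_cstar_algebra) = 0"
  by (metis add_cancel_right_left star_add)

lemma star_minus [simp]: "star (- x) = - star (x::'a::unital_cstar_algebra)"
  by (metis add_eq_0_iff star_add star_zero)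

lemma star_diff: "star (x - y) = star x - star (y::'a::unital_cstar_algebra)"
  by (metis add_uminus_conv_diff star_add star_minus)

lemma star_scaleR: "star (r *\<^sub>R x) = r *\<^sub>R star (x::'a::unital_cstar_algebra)"
  by (metis complex_cnj_complex_of_real scaleC_of_real star_scaleC)

lemma star_power: "star (x ^ n) = star (x::'a::unital_cstar_algebra) ^ n"
  by (induction n) (simp_all add: star_one star_mult power_commutes)

text \<open>The \<open>C*\<close>-identity and submultiplicativity bound the square of
  \<open>norm y\<close> by \<open>norm (star y) * norm y\<close>. Cancelling \<open>norm y\<close>
  gives one inequality, and applying it to \<open>star x\<close> gives the other.\<close>

lemma norm_star [simp]: "norm (star x) = norm (x::'a::unital_cstar_algebra)"
proof -
  have "norm y \<le> norm (star y)" for y :: 'a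
  proof (cases "y = 0")
    case False
    have "norm y * norm y \<le> norm (star y) * norm y"
      using norm_star_mult_self[of y] norm_mult_ineq[of "star y" y] by (simp add: power2_eq_square)
    with False show ?thesis by simp
  qed simp
  from this[of x] this[of "star x"] show ?thesis by (simp add: star_star)
qed

lemma norm_selfadjoint_square: "star a = a \<Longrightarrow> norm (a * a) = (norm (a::'a::unital_cstar_algebra))\<^sup>2"
  by (metis norm_star_mult_self)

lemma cartesian_decomposition:
  fixes x :: "'a::unital_cstar_algebra"
  obtains p q where "star p = p" "star q = q" "x = p + \<i> *\<^sub>C q"
proof
  let ?p = "(1/2) *\<^sub>R (x + star x)" and ?q = "(1/2) *\<^sub>R ((- \<i>) *\<^sub>C (x - star x))"
  show "star ?p = ?p" by (simp add: star_scaleR star_add star_star add.commute)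
  show "star ?q = ?q"
    by (simp add: star_scaleR star_scaleC star_diff star_star scaleC_minus_left
        flip: scaleC_minus_right)
  have "\<i> *\<^sub>C ?q = (1/2) *\<^sub>R (x - star x)"
    by (simp add: scaleC_scaleR scaleC_scaleC)
  then have "?p + \<i> *\<^sub>C ?q = (1/2 + 1/2) *\<^sub>R x"
    unfolding scaleR_add_left by (simp add: algebra_simps)
  then show "x = ?p + \<i> *\<^sub>C ?q" by simp
qed

text \<open>The commutator enters the two products with opposite signs, so it cancels in their sum
  and disappears when \<open>p\<close> and \<open>q\<close> commute.\<close>

lemma cartesian_products:
  fixes p q :: "'a::unital_cstar_algebra"
  assumes "star p = p" "star q = q"
  shows "star (p + \<i> *\<^sub>C q) * (p + \<i> *\<^sub>C q) = p * p + q * q + \<i> *\<^sub>C (p * q - q * p)"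
    and "(p + \<i> *\<^sub>C q) * star (p + \<i> *\<^sub>C q) = p * p + q * q - \<i> *\<^sub>C (p * q - q * p)"
  using assms
  by (simp_all add: star_add star_scaleC ring_distribs mult_scaleC_left mult_scaleC_right
      scaleC_scaleC scaleC_minus_left scaleC_add_right scaleC_minus_right
      del: add_uminus_conv_diff add: diff_conv_add_uminus)

lemma cartesian_sum:
  fixes p q :: "'a::unital_cstar_algebra"
  assumes "star p = p" "star q = q" "x = p + \<i> *\<^sub>C q"
  shows "star x * x + x * star x = 2 *\<^sub>R (p * p + q * q)"
  unfolding assms(3) cartesian_products[OF assms(1,2)] by (simp add: scaleR_2)

text \<open>This stands in for functional calculus: norms of elements such as \<open>h + i t\<close>
  or approximate unitaries are read off from \<open>p * p + q * q\<close>.\<close>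

lemma norm_cartesian_commuting:
  fixes p q :: "'a::unital_cstar_algebra"
  assumes "star p = p" "star q = q" "p * q = q * p"
  shows "(norm (p + \<i> *\<^sub>C q))\<^sup>2 = norm (p * p + q * q)"
  using cartesian_products(1)[OF assms(1,2)] assms(3) norm_star_mult_self[of "p + \<i> *\<^sub>C q"]
  by simp

section \<open>Elementary properties of states and the Kadison inequality\<close>

lemma
  assumes "\<phi> \<in> states"
  shows state_add: "\<phi> (x + y) = \<phi> x + \<phi> y"
    and state_diff: "\<phi> (x - y) = \<phi> x - \<phi> y"
    and state_scaleC: "\<phi> (c *\<^sub>C x) = c * \<phi> x"
    and state_scaleR: "\<phi> (r *\<^sub>R x) = r *\<^sub>R \<phi> x"
    and state_sum: "\<phi> (sum g A) = (\<Sum>i\<in>A. \<phi> (g i))"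
    and state_one: "\<phi> 1 = 1"
    and state_norm_le: "cmod (\<phi> x) \<le> norm x"
proof -
  have bl: "bounded_linear \<phi>" and "onorm \<phi> = 1"
    using assms by (auto simp: states_def dual_space_def)
  then interpret bounded_linear \<phi> by simp
  show "\<phi> (x + y) = \<phi> x + \<phi> y" "\<phi> (x - y) = \<phi> x - \<phi> y" "\<phi> (r *\<^sub>R x) = r *\<^sub>R \<phi> x"
    "\<phi> (sum g A) = (\<Sum>i\<in>A. \<phi> (g i))"
    by (fact add diff scaleR sum)+
  show "\<phi> (c *\<^sub>C x) = c * \<phi> x" "\<phi> 1 = 1"
    using assms by (auto simp: states_def dual_space_def)
  show "cmod (\<phi> x) \<le> norm x"
    using onorm[OF bl, of x] \<open>onorm \<phi> = 1\<close> by simp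
qed

lemma statesI:
  assumes add: "\<And>x y. \<phi> (x + y) = \<phi> x + \<phi> y"
    and scaleC: "\<And>c x. \<phi> (c *\<^sub>C x) = c * \<phi> x"
    and le: "\<And>x. cmod (\<phi> x) \<le> norm x"
    and one: "\<phi> (1::'a::unital_cstar_algebra) = 1"
  shows "\<phi> \<in> states"
proof -
  have bl: "bounded_linear \<phi>"
  proof (rule bounded_linear_intro[where K = 1])
    show "\<phi> (r *\<^sub>R x) = r *\<^sub>R \<phi> x" for r x
      by (metis scaleC scaleC_of_real scaleR_conv_of_real)
  qed (use add le in auto)
  have "onorm \<phi> \<le> 1" by (rule onorm_bound) (use le in auto)
  moreover have "1 \<le> onorm \<phi>" using onorm[OF bl, of 1] one by simp
  ultimately show ?thesis using bl one scaleC by (auto simp: states_def dual_space_def)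
qed

text \<open>Shift \<open>h\<close> by \<open>i t\<close>. The squared norm grows by at most the
  square of \<open>t\<close>, while the squared modulus of the state's value also gains the cross
  term \<open>2 * \<beta> * t\<close>. That term is therefore bounded above for all real
  \<open>t\<close>, which forces \<beta> to vanish.\<close>

lemma state_selfadjoint_real:
  fixes h :: "'a::unital_cstar_algebra"
  assumes \<phi>: "\<phi> \<in> states" and h: "star h = h"
  shows "\<phi> h = complex_of_real (Re (\<phi> h))"
proof -
  define \<beta> where "\<beta> = Im (\<phi> h)"
  have bound: "2 * \<beta> * t \<le> (norm h)\<^sup>2" for t
  proof -
    let ?z = "h + \<i> *\<^sub>C (t *\<^sub>R 1)"
    have "(norm ?z)\<^sup>2 = norm (h * h + (t * t) *\<^sub>R 1)"
      using norm_cartesian_commuting[of h "t *\<^sub>R 1"] h by (simp add: star_scaleR star_one)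
    also have "\<dots> \<le> (norm h)\<^sup>2 + t\<^sup>2"
      using norm_triangle_ineq[of "h * h" "(t * t) *\<^sub>R 1"] norm_selfadjoint_square[OF h]
      by (simp add: power2_eq_square)
    finally have "(cmod (\<phi> ?z))\<^sup>2 \<le> (norm h)\<^sup>2 + t\<^sup>2"
      using power_mono[OF state_norm_le[OF \<phi>, of ?z] norm_ge_zero, of 2] by linarith
    moreover have "(cmod (\<phi> ?z))\<^sup>2 = (Re (\<phi> h))\<^sup>2 + (\<beta> + t)\<^sup>2"
      by (simp add: cmod_power2 state_add[OF \<phi>] state_scaleC[OF \<phi>] state_scaleR[OF \<phi>]
          state_one[OF \<phi>] \<beta>_def)
    ultimately have "2 * \<beta> * t + ((Re (\<phi> h))\<^sup>2 + \<beta>\<^sup>2) \<le> (norm h)\<^sup>2"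
      by (simp add: power2_sum algebra_simps)
    then show ?thesis
      by (smt (verit) zero_le_power2)
  qed
  have "\<beta> = 0"
  proof (rule ccontr)
    assume "\<beta> \<noteq> 0"
    then show False using bound[of "((norm h)\<^sup>2 + 1) / (2 * \<beta>)"] by simp
  qed
  then show ?thesis by (simp add: complex_eq_iff \<beta>_def)
qed

text \<open>\<open>1 + i t h - t\<^sup>2 h\<^sup>2 / 2\<close> truncates the unitary \<open>exp (i t h)\<close>, and its
  norm exceeds 1 only by a term of order \<open>t\<^sup>4\<close>.\<close>

lemma state_kadison:
  fixes h :: "'a::unital_cstar_algebra"
  assumes \<phi>: "\<phi> \<in> states" and h: "star h = h"
  shows "(Re (\<phi> h))\<^sup>2 \<le> Re (\<phi> (h * h))"
proof (rule field_le_epsilon)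
  fix e :: real assume "e > 0"
  define r s where "r = Re (\<phi> h)" and "s = Re (\<phi> (h * h))"
  have hh: "star (h * h) = h * h" by (simp add: star_mult h)
  have r: "\<phi> h = of_real r" and s: "\<phi> (h * h) = of_real s"
    using state_selfadjoint_real[OF \<phi>] h hh by (auto simp: r_def s_def)
  \<comment> \<open>The added 1 keeps \<open>K\<close> positive even if the fourth power of
    \<open>h\<close> is zero. The choice of \<open>t\<close> makes the final error
    \<open>t\<^sup>2/4 * K\<close> equal to \<open>e\<close>.\<close>
  define K where "K = norm (h * h * (h * h)) + 1"
  have "K > 0" by (simp add: K_def add_nonneg_pos)
  define t where "t = sqrt (4 * e / K)"
  have t2: "t\<^sup>2 = 4 * e / K" and "t \<noteq> 0"
    using \<open>e > 0\<close> \<open>K > 0\<close> by (auto simp: t_def)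
  let ?p = "1 - (t\<^sup>2/2) *\<^sub>R (h * h)" and ?q = "t *\<^sub>R h"
  let ?u = "?p + \<i> *\<^sub>C ?q"
  \<comment> \<open>The quadratic terms of the two squares cancel, leaving only the fourth-order
    one.\<close>
  have "?p * ?p + ?q * ?q = 1 + (t^4/4) *\<^sub>R (h * h * (h * h))"
  proof -
    have "?p * ?p = 1 - (t\<^sup>2/2 + t\<^sup>2/2) *\<^sub>R (h * h) + (t^4/4) *\<^sub>R (h * h * (h * h))"
      unfolding scaleR_add_left by (simp add: algebra_simps power2_eq_square eval_nat_numeral)
    moreover have "?q * ?q = t\<^sup>2 *\<^sub>R (h * h)" by (simp add: power2_eq_square)
    ultimately show ?thesis by simp
  qed
  moreover have "?p * ?q = ?q * ?p" by (simp add: algebra_simps)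
  ultimately have "(norm ?u)\<^sup>2 = norm (1 + (t^4/4) *\<^sub>R (h * h * (h * h)))"
    using norm_cartesian_commuting[of ?p ?q] by (simp add: star_diff star_one star_scaleR h hh)
  also have "\<dots> \<le> 1 + t^4/4 * K"
  proof -
    have "norm (1 + (t^4/4) *\<^sub>R (h * h * (h * h))) \<le> 1 + t^4/4 * norm (h * h * (h * h))"
      using norm_triangle_ineq[of 1 "(t^4/4) *\<^sub>R (h * h * (h * h))"] by simp
    also have "\<dots> \<le> 1 + t^4/4 * K"
      unfolding K_def by (intro add_left_mono mult_left_mono) auto
    finally show ?thesis .
  qed
  finally have "(cmod (\<phi> ?u))\<^sup>2 \<le> 1 + t^4/4 * K"
    using power_mono[OF state_norm_le[OF \<phi>, of ?u] norm_ge_zero, of 2] by linarith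
  moreover have "\<phi> ?u = Complex (1 - t\<^sup>2/2 * s) (t * r)"
    by (simp add: state_add[OF \<phi>] state_diff[OF \<phi>] state_scaleC[OF \<phi>] state_scaleR[OF \<phi>]
        state_one[OF \<phi>] r s complex_eq_iff)
  ultimately have "(1 - t\<^sup>2/2 * s)\<^sup>2 + (t * r)\<^sup>2 \<le> 1 + t^4/4 * K"
    by (simp add: cmod_power2)
  then have "t\<^sup>2 * (r\<^sup>2 - s) \<le> t\<^sup>2 * (t\<^sup>2/4 * K) - (t\<^sup>2/2 * s)\<^sup>2"
    by (simp add: power2_eq_square eval_nat_numeral algebra_simps)
  then have "t\<^sup>2 * (r\<^sup>2 - s) \<le> t\<^sup>2 * (t\<^sup>2/4 * K)"
    by (smt (verit) zero_le_power2)
  then have "r\<^sup>2 - s \<le> t\<^sup>2/4 * K"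
    using \<open>t \<noteq> 0\<close> by (meson mult_le_cancel_left_pos zero_less_power2)
  also have "\<dots> = e" using \<open>K > 0\<close> by (simp add: t2)
  finally show "(Re (\<phi> h))\<^sup>2 \<le> Re (\<phi> (h * h)) + e" by (simp add: r_def s_def)
qed

lemma state_square_nonneg:
  "\<phi> \<in> states \<Longrightarrow> star h = h \<Longrightarrow> 0 \<le> Re (\<phi> (h * h))"
  by (meson order_trans state_kadison zero_le_power2)

section \<open>Positivity of states\<close>

text \<open>With \<open>1 - a = ((1 - a)\<^sup>2 + (1 - a\<^sup>2)) / 2\<close>, the deficit halves each time \<open>a\<close> is
  replaced by \<open>a\<^sup>2\<close>.\<close>

lemma state_square_times_one_minus_nonneg:
  fixes h a :: "'a::unital_cstar_algebra"
  assumes \<phi>: "\<phi> \<in> states" and h: "star h = h"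
    and a: "star a = a" "h * a = a * h" "norm a \<le> 1"
  shows "0 \<le> Re (\<phi> (h * h * (1 - a)))"
proof -
  have approx: "- (2 * norm (h * h)) * (1/2)^n \<le> Re (\<phi> (h * h * (1 - a)))"
    if "star a = a" "h * a = a * h" "norm a \<le> 1" for a :: 'a and n
    using that
  proof (induction n arbitrary: a)
    case 0
    have "\<bar>Re (\<phi> (h * h * (1 - a)))\<bar> \<le> norm (h * h * (1 - a))"
      using abs_Re_le_cmod state_norm_le[OF \<phi>] order_trans by blast
    also have "\<dots> \<le> norm (h * h) * norm (1 - a)" by (rule norm_mult_ineq)
    also have "\<dots> \<le> norm (h * h) * 2"
      using norm_triangle_ineq4[of 1 a] 0 by (intro mult_left_mono) auto
    finally show ?case by simp
  next
    case (Suc n)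
    \<comment> \<open>Since \<open>h\<close> and \<open>a\<close> commute, \<open>?w\<close> is
      selfadjoint and its square carries the term with \<open>(1 - a) * (1 - a)\<close>. The
      induction hypothesis, applied to \<open>a * a\<close>, handles the rest.\<close>
    let ?w = "h * (1 - a)"
    have comm: "h * (1 - a) = (1 - a) * h" using Suc.prems by (simp add: algebra_simps)
    have w: "star ?w = ?w" using comm by (simp add: star_mult star_diff star_one h Suc.prems)
    have aa: "h * (a * a) = a * a * h" using Suc.prems by (metis mult.assoc)
    have "norm (a * a) \<le> 1"
      using norm_selfadjoint_square[OF Suc.prems(1)] Suc.prems(3) by (simp add: power_le_one)
    with Suc.IH[of "a * a"] Suc.prems(1) aa
    have IH: "- (2 * norm (h * h)) * (1/2)^n \<le> Re (\<phi> (h * h * (1 - a * a)))"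
      by (simp add: star_mult)
    have "?w * ?w = h * h * ((1 - a) * (1 - a))" using comm by (metis mult.assoc)
    then have "?w * ?w + h * h * (1 - a * a) = h * h * ((1 - a) * (1 - a) + (1 - a * a))"
      by (simp add: distrib_left)
    also have "(1 - a) * (1 - a) + (1 - a * a) = 2 *\<^sub>R (1 - a)"
      by (simp add: algebra_simps scaleR_2)
    finally have "h * h * (1 - a) = (1/2) *\<^sub>R (?w * ?w + h * h * (1 - a * a))" by simp
    then have "Re (\<phi> (h * h * (1 - a))) = (Re (\<phi> (?w * ?w)) + Re (\<phi> (h * h * (1 - a * a)))) / 2"
      by (simp add: state_add[OF \<phi>] state_scaleR[OF \<phi>])
    then show ?case using IH state_square_nonneg[OF \<phi> w] by simp
  qed
  have "(\<lambda>n. - (2 * norm (h * h)) * (1/2)^n) \<longlonglongrightarrow> - (2 * norm (h * h)) * 0"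
    by (intro tendsto_mult_left LIMSEQ_power_zero) simp
  then show ?thesis
    using approx[OF a] by (intro LIMSEQ_le_const2[of _ 0]) auto
qed

lemma power_commute_mult:
  fixes h b :: "'a::monoid_mult"
  assumes "h * b = b * h"
  shows "h * b ^ k * (h * b ^ k) = h * h * b ^ (2 * k)"
proof -
  have "b ^ k * h = h * b ^ k" using power_commuting_commutes[OF assms[symmetric], of k] by simp
  then show ?thesis by (simp add: mult.assoc mult_2 power_add flip: mult.assoc[of "b ^ k" h])
qed

text \<open>Half of the even part of the power is absorbed into \<open>h\<close>, giving a
  selfadjoint \<open>w\<close> that commutes with \<open>a\<close>. What remains is
  \<open>w * w\<close>, times one factor \<open>1 - a\<close> if \<open>n\<close> is odd.\<close>

lemma state_square_times_power_nonneg: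
  fixes h a :: "'a::unital_cstar_algebra"
  assumes \<phi>: "\<phi> \<in> states" and h: "star h = h"
    and a: "star a = a" "h * a = a * h" "norm a \<le> 1"
  shows "0 \<le> Re (\<phi> (h * h * (1 - a) ^ n))"
proof -
  define b where "b = 1 - a"
  have b: "h * b = b * h" using a by (simp add: b_def algebra_simps)
  have "star b = b" by (simp add: b_def star_diff star_one a)
  define w where "w = h * b ^ (n div 2)"
  have w: "star w = w"
    using power_commuting_commutes[OF b[symmetric], of "n div 2"]
    by (simp add: w_def star_mult star_power h \<open>star b = b\<close>)
  have "w * a = a * w"
  proof -
    have "b ^ (n div 2) * a = a * b ^ (n div 2)"
      by (rule power_commuting_commutes) (simp add: b_def algebra_simps)
    then show ?thesis unfolding w_def by (metis a(2) mult.assoc)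
  qed
  have ww: "w * w = h * h * b ^ (2 * (n div 2))"
    unfolding w_def by (rule power_commute_mult[OF b])
  show ?thesis
  proof (cases "even n")
    case True
    then show ?thesis using state_square_nonneg[OF \<phi> w] ww by (simp add: b_def)
  next
    case False
    then have "b ^ n = b ^ (2 * (n div 2)) * b"
      by (metis odd_two_times_div_two_succ power_Suc2 Suc_eq_plus1)
    then have "h * h * (1 - a) ^ n = w * w * (1 - a)"
      using ww by (simp add: b_def mult.assoc)
    then show ?thesis
      using state_square_times_one_minus_nonneg[OF \<phi> w a(1) \<open>w * a = a * w\<close> a(3)] by simp
  qed
qed

text \<open>Consecutive arguments differ by \<open>a * a * (1 - a) ^ n\<close>, where the state is
  nonnegative.\<close>

lemma state_times_power_antimono:
  fixes a :: "'a::unital_cstar_algebra"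
  assumes \<phi>: "\<phi> \<in> states" and a: "star a = a" "norm a \<le> 1" and "m \<le> n"
  shows "Re (\<phi> (a * (1 - a) ^ n)) \<le> Re (\<phi> (a * (1 - a) ^ m))"
  using \<open>m \<le> n\<close>
proof (rule lift_Suc_antimono_le[where f = "\<lambda>n. Re (\<phi> (a * (1 - a) ^ n))", rotated])
  fix n
  have "(1 - a) ^ n * a = a * (1 - a) ^ n"
    by (rule power_commuting_commutes) (simp add: algebra_simps)
  then have "a * (1 - a) ^ n - a * (1 - a) ^ Suc n = a * a * (1 - a) ^ n"
    by (simp add: power_Suc2 right_diff_distrib mult.assoc del: power_Suc)
  then show "Re (\<phi> (a * (1 - a) ^ Suc n)) \<le> Re (\<phi> (a * (1 - a) ^ n))"
    using state_square_times_power_nonneg[OF \<phi> a(1) a(1) refl a(2), of n]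
    by (metis diff_ge_0_iff_ge minus_complex.sel(1) state_diff[OF \<phi>])
qed

text \<open>By monotonicity, \<open>n\<close> copies of the last value are at most the sum of the
  earlier ones, and that sum telescopes. The resulting decay of order \<open>1/n\<close> makes the
  value at \<open>y * star y\<close> negligible later on.\<close>

lemma state_times_power_le:
  fixes a :: "'a::unital_cstar_algebra"
  assumes \<phi>: "\<phi> \<in> states" and a: "star a = a" "norm a \<le> 1"
  shows "real n * Re (\<phi> (a * (1 - a) ^ n)) \<le> 1"
proof -
  have "real n * Re (\<phi> (a * (1 - a) ^ n)) = (\<Sum>j<n. Re (\<phi> (a * (1 - a) ^ n)))" by simp
  also have "\<dots> \<le> (\<Sum>j<n. Re (\<phi> (a * (1 - a) ^ j)))"
    by (intro sum_mono state_times_power_antimono[OF \<phi> a]) auto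
  also have "\<dots> = Re (\<phi> (\<Sum>j<n. a * (1 - a) ^ j))"
    by (simp add: state_sum[OF \<phi>])
  also have "(\<Sum>j<n. a * (1 - a) ^ j) = 1 - (1 - a) ^ n"
  proof (induction n)
    case (Suc n)
    then show ?case by (simp add: algebra_simps)
  qed simp
  \<comment> \<open>Nonnegativity at \<open>(1 - a) ^ n\<close> is the previous positivity result
    with \<open>h = 1\<close>.\<close>
  also have "Re (\<phi> (1 - (1 - a) ^ n)) \<le> 1"
    using state_square_times_power_nonneg[OF \<phi> star_one a(1) _ a(2), of n]
    by (simp add: state_diff[OF \<phi>] state_one[OF \<phi>])
  finally show ?thesis .
qed

lemma state_cartesian_sum_nonneg:
  assumes \<phi>: "\<phi> \<in> states"
  shows "0 \<le> Re (\<phi> (star x * x)) + Re (\<phi> (x * star (x::'a::unital_cstar_algebra)))"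
proof -
  obtain p q where pq: "star p = p" "star q = q" "x = p + \<i> *\<^sub>C q"
    by (rule cartesian_decomposition)
  have "Re (\<phi> (star x * x + x * star x)) = 2 * (Re (\<phi> (p * p)) + Re (\<phi> (q * q)))"
    unfolding cartesian_sum[OF pq] by (simp add: state_add[OF \<phi>] state_scaleR[OF \<phi>])
  then show ?thesis
    using state_square_nonneg[OF \<phi> pq(1)] state_square_nonneg[OF \<phi> pq(2)]
    by (simp add: state_add[OF \<phi>])
qed

text \<open>A negative value of the state at \<open>p = x\<^sup>* x\<close> would persist at \<open>y\<^sup>* y\<close> for
  \<open>y = x (1 - p)\<^sup>n\<close>, whereas \<open>y y\<^sup>*\<close> becomes negligible; but the real part of the state is
  nonnegative at \<open>y\<^sup>* y + y y\<^sup>*\<close>, a sum of squares of selfadjoint elements.\<close>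

lemma state_star_mult_nonneg:
  fixes x :: "'a::unital_cstar_algebra"
  assumes \<phi>: "\<phi> \<in> states"
  shows "0 \<le> Re (\<phi> (star x * x))"
proof -
  have contraction: "0 \<le> Re (\<phi> (star x * x))" if "norm x \<le> 1" for x :: 'a
  proof -
    define p q where "p = star x * x" and "q = x * star x"
    have p: "star p = p" "norm p \<le> 1"
      using that by (simp_all add: p_def star_mult star_star norm_star_mult_self power_le_one)
    have q: "star q = q" "norm q \<le> 1"
      using that norm_star_mult_self[of "star x"]
      by (simp_all add: q_def star_mult star_star power_le_one)
    \<comment> \<open>Since \<open>x * p = q * x\<close>, powers of \<open>1 - p\<close> move
      through \<open>x\<close> as powers of \<open>1 - q\<close>. This turns
      \<open>y * star y\<close> into a polynomial in \<open>q\<close> alone.\<close>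
    have xp: "x * (1 - p) ^ n = (1 - q) ^ n * x" for n
    proof (induction n)
      case (Suc n)
      have "x * (1 - p) ^ Suc n = (x * (1 - p) ^ n) * (1 - p)"
        by (simp add: power_Suc2 mult.assoc del: power_Suc)
      also have "\<dots> = (1 - q) ^ n * (x * (1 - p))" using Suc by (simp add: mult.assoc)
      also have "x * (1 - p) = (1 - q) * x" by (simp add: p_def q_def algebra_simps)
      finally show ?case by (simp add: power_Suc2 mult.assoc del: power_Suc)
    qed simp
    have bound: "- (1 / (2 * real n)) \<le> Re (\<phi> p)" if "n > 0" for n
    proof -
      define y where "y = x * (1 - p) ^ n"
      have sy: "star y = (1 - p) ^ n * star x"
        by (simp add: y_def star_mult star_power star_diff star_one p)
      have pc: "(1 - p) ^ n * p = p * (1 - p) ^ n"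
        by (rule power_commuting_commutes) (simp add: algebra_simps)
      have qc: "(1 - q) ^ m * q = q * (1 - q) ^ m" for m
        by (rule power_commuting_commutes) (simp add: algebra_simps)
      have "star y * y = ((1 - p) ^ n * p) * (1 - p) ^ n"
        unfolding sy unfolding y_def p_def by (simp only: mult.assoc)
      then have yy1: "star y * y = p * (1 - p) ^ (2 * n)"
        unfolding pc by (simp add: mult.assoc mult_2 power_add)
      have "y * star y = (x * (1 - p) ^ (2 * n)) * star x"
        unfolding sy unfolding y_def mult_2 power_add by (simp only: mult.assoc)
      also have "\<dots> = (1 - q) ^ (2 * n) * q" unfolding xp by (simp add: q_def mult.assoc)
      finally have yy2: "y * star y = q * (1 - q) ^ (2 * n)" by (simp add: qc)
      have "Re (\<phi> (q * (1 - q) ^ (2 * n))) \<le> 1 / (2 * real n)"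
        using state_times_power_le[OF \<phi> q, of "2 * n"] that by (simp add: field_simps)
      moreover have "Re (\<phi> (p * (1 - p) ^ (2 * n))) \<le> Re (\<phi> p)"
        using state_times_power_antimono[OF \<phi> p, of 0 "2 * n"] by simp
      ultimately show ?thesis
        using state_cartesian_sum_nonneg[OF \<phi>, of y] by (simp add: yy1 yy2)
    qed
    have "(\<lambda>n. - (1 / (2 * real n))) \<longlonglongrightarrow> 0" by real_asymp
    then have "0 \<le> Re (\<phi> p)"
      using bound by (intro LIMSEQ_le_const2[of _ 0]) (auto intro!: exI[of _ 1])
    then show ?thesis by (simp add: p_def)
  qed
  show ?thesis
  proof (cases "x = 0")
    case True
    then show ?thesis using state_scaleR[OF \<phi>, of 0] by simp
  next
    case False
    define y where "y = (1 / norm x) *\<^sub>R x"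
    have "x = norm x *\<^sub>R y" "norm y \<le> 1" using False by (auto simp: y_def)
    moreover from this have "star x * x = (norm x)\<^sup>2 *\<^sub>R (star y * y)"
      by (metis (no_types) mult_scaleR_left mult_scaleR_right power2_eq_square scaleR_scaleR star_scaleR)
    ultimately show ?thesis using contraction[of y] by (simp add: state_scaleR[OF \<phi>])
  qed
qed

section \<open>Norming functionals\<close>

definition sublinear :: "('a::real_vector \<Rightarrow> real) \<Rightarrow> bool" where
  "sublinear q \<longleftrightarrow> (\<forall>x y. q (x + y) \<le> q x + q y) \<and> (\<forall>r\<ge>0. \<forall>x. q (r *\<^sub>R x) = r * q x)"

text \<open>An inequality suffices for homogeneity: using it for \<open>inverse r\<close> at
  \<open>r *\<^sub>R x\<close> yields the reverse one.\<close>

lemma sublinearI: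
  assumes "\<And>x y. q (x + y) \<le> q x + q y" and "q 0 = 0"
    and "\<And>r x. r > 0 \<Longrightarrow> q (r *\<^sub>R x) \<le> r * q x"
  shows "sublinear q"
proof -
  have "q (r *\<^sub>R x) = r * q x" if "r \<ge> 0" for r x
  proof (cases "r = 0")
    case False
    with that have "r > 0" by simp
    have "q x \<le> inverse r * q (r *\<^sub>R x)"
      using assms(3)[of "inverse r" "r *\<^sub>R x"] \<open>r > 0\<close> by simp
    then have "r * q x \<le> q (r *\<^sub>R x)" using \<open>r > 0\<close> by (simp add: field_simps)
    then show ?thesis using assms(3)[OF \<open>r > 0\<close>, of x] by simp
  qed (use assms(2) in auto)
  then show ?thesis using assms(1) by (simp add: sublinear_def)
qed

lemma sublinear_add: "sublinear q \<Longrightarrow> q (x + y) \<le> q x + q y"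
  and sublinear_scaleR: "sublinear q \<Longrightarrow> r \<ge> 0 \<Longrightarrow> q (r *\<^sub>R x) = r * q x"
  by (simp_all add: sublinear_def)

lemma sublinear_zero: "sublinear q \<Longrightarrow> q 0 = 0"
  using sublinear_scaleR[of q 0] by force

lemma sublinear_minus: "sublinear q \<Longrightarrow> - q (- x) \<le> q x"
  using sublinear_add[of q x "- x"] sublinear_zero[of q] by simp

text \<open>Take \<open>r x\<close> as the infimum of \<open>q (x + t *\<^sub>R y) - t * q y\<close>
  over \<open>t \<ge> 0\<close>; the values are bounded below by \<open>- q (- x)\<close>. The
  choice \<open>t = 0\<close> gives \<open>r \<le> q\<close>, and \<open>t = 1\<close> gives the
  bound at \<open>- y\<close>. It is used both to show that minimal sublinear functions are odd and
  to prescribe a value before extending.\<close>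

lemma sublinear_lower:
  assumes "sublinear q"
  obtains r where "sublinear r" "\<And>x. r x \<le> q x" "r (- y) \<le> - q y"
proof
  define g where "g x t = q (x + t *\<^sub>R y) - t * q y" for x t
  define r where "r x = (INF t\<in>{0..}. g x t)" for x
  have low: "- q (- x) \<le> g x t" if "t \<ge> 0" for x t
    using sublinear_add[OF assms, of "x + t *\<^sub>R y" "- x"] sublinear_scaleR[OF assms that]
    by (simp add: g_def)
  have bdd: "bdd_below (g x ` {0..})" for x
    using low by (auto intro!: bdd_belowI2)
  have le: "r x \<le> g x t" if "t \<ge> 0" for x t
    unfolding r_def by (rule cINF_lower[OF bdd]) (use that in auto)
  have greatest: "c \<le> r x" if "\<And>t. t \<ge> 0 \<Longrightarrow> c \<le> g x t" for c x
    unfolding r_def by (rule cINF_greatest) (use that in auto)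
  show "r x \<le> q x" for x using le[of 0 x] by (simp add: g_def)
  show "r (- y) \<le> - q y" using le[of 1 "- y"] by (simp add: g_def sublinear_zero[OF assms])
  show "sublinear r"
  proof (rule sublinearI)
    fix x z
    have g_add: "r (x + z) \<le> g x s + g z t" if "s \<ge> 0" "t \<ge> 0" for s t
    proof -
      have "r (x + z) \<le> g (x + z) (s + t)" using that by (intro le) auto
      also have "\<dots> \<le> g x s + g z t"
        using sublinear_add[OF assms, of "x + s *\<^sub>R y" "z + t *\<^sub>R y"]
        by (simp add: g_def algebra_simps)
      finally show ?thesis .
    qed
    \<comment> \<open>The two infima are taken one at a time, first over the parameter of
      \<open>z\<close> with \<open>s\<close> fixed.\<close>
    have "r (x + z) - g x s \<le> r z" if "s \<ge> 0" for s
      using g_add[OF that] by (intro greatest) (simp add: algebra_simps)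
    then have "r (x + z) - r z \<le> r x" by (intro greatest) (simp add: algebra_simps)
    then show "r (x + z) \<le> r x + r z" by simp
  next
    have "0 \<le> r 0" by (intro greatest) (use low[of _ 0] sublinear_zero[OF assms] in auto)
    then show "r 0 = 0" using le[of 0 0] by (simp add: g_def sublinear_zero[OF assms])
  next
    fix c :: real and x assume "c > 0"
    have "r (c *\<^sub>R x) \<le> c * g x t" if "t \<ge> 0" for t
    proof -
      have "r (c *\<^sub>R x) \<le> g (c *\<^sub>R x) (c * t)" using that \<open>c > 0\<close> by (intro le) auto
      also have "\<dots> = c * g x t"
        using sublinear_scaleR[OF assms, of c "x + t *\<^sub>R y"] \<open>c > 0\<close>
        by (simp add: g_def algebra_simps)
      finally show ?thesis .
    qed
    then have "r (c *\<^sub>R x) / c \<le> r x"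
      using \<open>c > 0\<close> by (intro greatest) (simp add: field_simps)
    then show "r (c *\<^sub>R x) \<le> c * r x" using \<open>c > 0\<close> by (simp add: field_simps)
  qed
qed

text \<open>For subadditivity, different members may be nearly optimal at \<open>x\<close> and at
  \<open>y\<close>. Totality supplies a single member below both, whose own subadditivity then
  applies.\<close>

lemma sublinear_INF_chain:
  assumes C: "C \<noteq> {}" "\<And>q. q \<in> C \<Longrightarrow> sublinear q"
    and total: "\<And>q r. q \<in> C \<Longrightarrow> r \<in> C \<Longrightarrow> q \<le> r \<or> r \<le> q"
    and bdd: "\<And>x. bdd_below ((\<lambda>q. q x) ` C)"
  shows "sublinear (\<lambda>x. INF q\<in>C. q x)"
proof (rule sublinearI)
  let ?u = "\<lambda>x. INF q\<in>C. q x"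
  have le: "?u x \<le> q x" if "q \<in> C" for q x by (rule cINF_lower[OF bdd that])
  have greatest: "c \<le> ?u x" if "\<And>q. q \<in> C \<Longrightarrow> c \<le> q x" for c x
    by (rule cINF_greatest) (use that C in auto)
  fix x y
  have le_add: "?u (x + y) \<le> q x + r y" if qr: "q \<in> C" "r \<in> C" for q r
  proof -
    obtain s where s: "s \<in> C" "s x \<le> q x" "s y \<le> r y"
      using total[OF qr] qr by (auto simp: le_fun_def)
    then show ?thesis
      using le[OF s(1), of "x + y"] sublinear_add[OF C(2)[OF s(1)], of x y] by linarith
  qed
  have "?u (x + y) - q x \<le> ?u y" if "q \<in> C" for q
    by (intro greatest) (use le_add[OF that] in \<open>simp add: algebra_simps\<close>)
  then have "?u (x + y) - ?u y \<le> ?u x" by (intro greatest) (simp add: algebra_simps)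
  then show "?u (x + y) \<le> ?u x + ?u y" by simp
next
  have "q 0 = 0" if "q \<in> C" for q using sublinear_zero[OF C(2)[OF that]] .
  then have "(\<lambda>q. q 0) ` C = (\<lambda>q. 0) ` C" by (intro image_cong refl)
  also have "\<dots> = {0}" using C(1) by (simp only: image_constant_conv if_False)
  finally show "(INF q\<in>C. q 0) = 0" by (simp only: cInf_singleton)
next
  let ?u = "\<lambda>x. INF q\<in>C. q x"
  fix c :: real and x assume "c > 0"
  have le: "?u (c *\<^sub>R x) / c \<le> q x" if "q \<in> C" for q
  proof -
    have "?u (c *\<^sub>R x) \<le> q (c *\<^sub>R x)" by (rule cINF_lower[OF bdd that])
    also have "\<dots> = c * q x" by (rule sublinear_scaleR[OF C(2)[OF that]]) (use \<open>c > 0\<close> in linarith)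
    finally show ?thesis unfolding pos_divide_le_eq[OF \<open>c > 0\<close>] by (simp only: mult.commute)
  qed
  have "?u (c *\<^sub>R x) / c \<le> ?u x" by (rule cINF_greatest[OF C(1) le])
  then show "?u (c *\<^sub>R x) \<le> c * ?u x"
    unfolding pos_divide_le_eq[OF \<open>c > 0\<close>] by (simp only: mult.commute)
qed

text \<open>A minimal sublinear function \<open>m\<close> is odd, because a sublinear \<open>r \<le> m\<close> with
  \<open>r (- y) \<le> - m y\<close> must be \<open>m\<close> itself; an odd sublinear function is linear.\<close>

lemma hahn_banach_sublinear:
  assumes p: "sublinear p"
  obtains f where "linear f" "\<And>x. f x \<le> p x"
proof -
  define A where "A = {q. sublinear q \<and> q \<le> p}"
  \<comment> \<open>The order is reversed, so that the maximal element given by Zorn's lemma is a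
    minimal sublinear function.\<close>
  let ?R = "\<lambda>q r :: 'a \<Rightarrow> real. r \<le> q"
  have "\<exists>m\<in>A. \<forall>q\<in>A. q \<le> m \<longrightarrow> q = m"
  proof (rule predicate_Zorn)
    show "partial_order_on A (relation_of ?R A)"
      by (rule partial_order_on_relation_ofI) auto
  next
    fix C assume "C \<in> Chains (relation_of ?R A)"
    then have total: "q \<in> A \<and> r \<in> A \<and> (r \<le> q \<or> q \<le> r)" if "q \<in> C" "r \<in> C" for q r
      using that by (auto simp: Chains_def relation_of_def)
    show "\<exists>u\<in>A. \<forall>q\<in>C. u \<le> q"
    proof (cases "C = {}")
      case True
      then show ?thesis using p by (auto simp: A_def intro!: bexI[of _ p])
    next
      case False
      \<comment> \<open>Every sublinear function below \<open>p\<close> is at least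
        \<open>- p (- x)\<close> at \<open>x\<close>, so the pointwise infimum over the chain
        exists.\<close>
      have bdd: "bdd_below ((\<lambda>q. q x) ` C)" for x
      proof (rule bdd_belowI2)
        fix q assume "q \<in> C"
        then have "sublinear q" "q (- x) \<le> p (- x)"
          using total[of q q] by (auto simp: A_def le_fun_def)
        then show "- p (- x) \<le> q x" using sublinear_minus[of q x] by linarith
      qed
      let ?u = "\<lambda>x. INF q\<in>C. q x"
      have "sublinear ?u"
        by (rule sublinear_INF_chain[OF False _ _ bdd]) (use total in \<open>auto simp: A_def\<close>)
      moreover have lower: "?u \<le> q" if "q \<in> C" for q
        using cINF_lower[OF bdd that] by (auto simp: le_fun_def)
      moreover obtain q where "q \<in> C" using False by auto
      moreover have "q \<le> p" using total[of q q] \<open>q \<in> C\<close> by (simp add: A_def)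
      ultimately show ?thesis by (intro bexI[of _ ?u]) (auto simp: A_def intro: order_trans)
    qed
  qed
  then obtain m where m: "sublinear m" "m \<le> p" and
    min: "\<And>q. sublinear q \<Longrightarrow> q \<le> m \<Longrightarrow> q = m"
    by (auto simp: A_def intro: order_trans)
  have odd: "m (- y) = - m y" for y
  proof -
    obtain r where "sublinear r" "\<And>x. r x \<le> m x" "r (- y) \<le> - m y"
      using sublinear_lower[OF m(1)] by blast
    with min[of r] have "m (- y) \<le> - m y" by (auto simp: le_fun_def)
    with sublinear_minus[OF m(1), of y] show ?thesis by linarith
  qed
  have "linear m"
  proof (rule linearI)
    fix x y
    have "m (- x + - y) \<le> m (- x) + m (- y)" by (rule sublinear_add[OF m(1)])
    then have "m x + m y \<le> m (x + y)"
      using odd[of "x + y"] by (simp add: odd)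
    then show "m (x + y) = m x + m y" using sublinear_add[OF m(1), of x y] by linarith
  next
    fix c x
    show "m (c *\<^sub>R x) = c *\<^sub>R m x"
    proof (cases "c \<ge> 0")
      case False
      have "m (c *\<^sub>R x) = m ((- c) *\<^sub>R (- x))" by simp
      also have "\<dots> = c * m x" using False by (subst sublinear_scaleR[OF m(1)]) (auto simp: odd)
      finally show ?thesis by simp
    qed (simp add: sublinear_scaleR[OF m(1)])
  qed
  then show ?thesis using m(2) that by (auto simp: le_fun_def)
qed

text \<open>The norm is first lowered to a sublinear \<open>r\<close> with
  \<open>r (- z) \<le> - norm z\<close>. Every linear functional below \<open>r\<close> then takes
  the value \<open>norm z\<close> at \<open>z\<close>.\<close>

lemma real_norming_functional:
  fixes z :: "'a::real_normed_vector"
  obtains f where "linear f" "\<And>x. f x \<le> norm x" "f z = norm z"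
proof -
  have "sublinear (norm :: 'a \<Rightarrow> real)"
    by (rule sublinearI) (auto simp: norm_triangle_ineq)
  then obtain r where r: "sublinear r" "\<And>x. r x \<le> norm x" "r (- z) \<le> - norm z"
    using sublinear_lower by blast
  obtain f where f: "linear f" "\<And>x. f x \<le> r x"
    using hahn_banach_sublinear[OF r(1)] by blast
  have "f z = norm z"
    using f(2)[of "- z"] f(2)[of z] r(2)[of z] r(3) linear_neg[OF f(1), of z] by linarith
  then show ?thesis using that[of f] f order_trans[OF f(2) r(2)] by blast
qed

text \<open>A real norming functional \<open>f\<close> becomes the real part of the complex-linear
  \<open>f x - i f (i x)\<close>.\<close>

lemma norming_functional:
  fixes z :: "'a::unital_cstar_algebra"
  obtains \<phi> :: "'a \<Rightarrow> complex" where
    "\<And>x y. \<phi> (x + y) = \<phi> x + \<phi> y" "\<And>c x. \<phi> (c *\<^sub>C x) = c * \<phi> x"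
    "\<And>x. cmod (\<phi> x) \<le> norm x" "\<phi> z = of_real (norm z)"
proof -
  obtain f where f: "linear f" "\<And>x. f x \<le> norm x" "f z = norm z"
    using real_norming_functional[of z] by blast
  interpret linear f by (fact f)
  define \<phi> where "\<phi> x = Complex (f x) (- f (\<i> *\<^sub>C x))" for x
  have \<phi>_add: "\<phi> (x + y) = \<phi> x + \<phi> y" for x y
    by (simp add: \<phi>_def add scaleC_add_right complex_eq_iff)
  have \<phi>_scaleC: "\<phi> (c *\<^sub>C x) = c * \<phi> x" for c x
  proof -
    have "c *\<^sub>C x = Re c *\<^sub>R x + Im c *\<^sub>R (\<i> *\<^sub>C x)"
      by (metis complex_eq mult.commute scaleC_add_left scaleC_of_real scaleC_scaleC)
    moreover have "\<i> *\<^sub>C (c *\<^sub>C x) = Re c *\<^sub>R (\<i> *\<^sub>C x) + (- Im c) *\<^sub>R x"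
      unfolding calculation
      by (simp add: scaleC_add_right scaleC_scaleR scaleC_scaleC scaleC_minus_left)
    ultimately show ?thesis by (simp add: \<phi>_def add diff scale complex_eq_iff)
  qed
  have \<phi>_le: "cmod (\<phi> x) \<le> norm x" for x
  proof (cases "\<phi> x = 0")
    case False
    \<comment> \<open>The unimodular \<open>c\<close> rotates \<open>\<phi> x\<close> onto its
      modulus, where \<phi> agrees with \<open>f\<close>.\<close>
    define c where "c = cnj (\<phi> x) / cmod (\<phi> x)"
    have "cmod c = 1" using False by (simp add: c_def norm_divide)
    have "\<phi> (c *\<^sub>C x) = of_real ((cmod (\<phi> x))\<^sup>2) / of_real (cmod (\<phi> x))"
      unfolding complex_norm_square by (simp add: \<phi>_scaleC c_def mult.commute)
    then have "\<phi> (c *\<^sub>C x) = cmod (\<phi> x)"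
      using False by (simp add: power2_eq_square)
    then have "cmod (\<phi> x) = f (c *\<^sub>C x)" by (simp add: \<phi>_def complex_eq_iff)
    also have "\<dots> \<le> norm x" using f(2)[of "c *\<^sub>C x"] by (simp add: norm_scaleC \<open>cmod c = 1\<close>)
    finally show ?thesis .
  qed simp
  have "Re (\<phi> z) = norm z" by (simp add: \<phi>_def f)
  moreover have "(cmod (\<phi> z))\<^sup>2 \<le> (norm z)\<^sup>2" using \<phi>_le by (intro power_mono) auto
  ultimately have "\<phi> z = of_real (norm z)"
    by (simp add: cmod_power2 complex_eq_iff)
  then show ?thesis by (rule that[OF \<phi>_add \<phi>_scaleC \<phi>_le])
qed

section \<open>Norming states\<close>

lemma continuous_on_star: "continuous_on S (star :: 'a::unital_cstar_algebra \<Rightarrow> 'a)"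
proof -
  have "bounded_linear (star :: 'a \<Rightarrow> 'a)"
    by (rule bounded_linear_intro[where K = 1]) (auto simp: star_add star_scaleR)
  then show ?thesis by (rule linear_continuous_on)
qed

text \<open>The substitution \<open>k = 1 - y\<close> turns \<open>k\<^sup>2 = 1 - z\<close> into the fixed point equation
  \<open>y = (z + y\<^sup>2) / 2\<close> of a contraction.\<close>

lemma square_root_one_minus:
  fixes z a :: "'a::unital_cstar_algebra"
  assumes z: "star z = z" "norm z < 1" "a * z = z * a"
  obtains k where "star k = k" "a * k = k * a" "k * k = 1 - z"
proof -
  define r where "r = norm z"
  \<comment> \<open>Selfadjointness and commutation with \<open>a\<close> are closed conditions, so
    they are built into \<open>S\<close> and pass to the fixed point. On the ball of radius
    \<open>r < 1\<close> the map contracts with constant \<open>r\<close>.\<close>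
  define S where "S = {y. star y = y} \<inter> {y. a * y = y * a} \<inter> cball 0 r"
  define f where "f y = (1/2) *\<^sub>R (z + y * y)" for y
  have r: "0 \<le> r" "r < 1" using z(2) by (simp_all add: r_def)
  have "closed S" unfolding S_def
    by (intro closed_Int closed_Collect_eq continuous_on_star continuous_intros closed_cball)
  then have complete: "complete S" by (simp add: complete_eq_closed)
  have "0 \<in> S" by (simp add: S_def r)
  then have nonempty: "S \<noteq> {}" by blast
  have self_map: "f ` S \<subseteq> S"
  proof (rule image_subsetI)
    fix y assume y: "y \<in> S"
    have "norm (f y) \<le> (norm z + norm y * norm y) / 2"
      using norm_triangle_ineq[of z "y * y"] norm_mult_ineq[of y y] by (simp add: f_def)
    also have "\<dots> \<le> (r + r * 1) / 2"
      using y z(2) by (intro divide_right_mono add_mono mult_mono) (auto simp: S_def r_def)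
    finally have "norm (f y) \<le> r" by simp
    moreover have "a * (y * y) = y * y * a" using y by (simp add: S_def) (metis mult.assoc)
    ultimately show "f y \<in> S"
      using y z by (simp add: S_def f_def star_scaleR star_add star_mult algebra_simps)
  qed
  have lipschitz: "dist (f x) (f y) \<le> r * dist x y" if "x \<in> S" "y \<in> S" for x y
  proof -
    have "f x - f y = (1/2) *\<^sub>R (x * (x - y) + (x - y) * y)"
      by (simp add: f_def algebra_simps)
    then have "norm (f x - f y) \<le> (norm x * norm (x - y) + norm (x - y) * norm y) / 2"
      using norm_triangle_ineq[of "x * (x - y)" "(x - y) * y"] norm_mult_ineq[of x "x - y"]
        norm_mult_ineq[of "x - y" y] by simp
    also have "\<dots> \<le> (r * norm (x - y) + norm (x - y) * r) / 2"
      using that by (intro divide_right_mono add_mono mult_mono) (auto simp: S_def r_def)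
    finally show ?thesis by (simp add: dist_norm)
  qed
  obtain y where y: "y \<in> S" "f y = y"
    using Banach_fix[OF complete nonempty r self_map lipschitz] by blast
  then have "2 *\<^sub>R y = 2 *\<^sub>R f y" by simp
  then have "2 *\<^sub>R y = z + y * y" by (simp add: f_def)
  then have "(1 - y) * (1 - y) = 1 - z" by (simp add: algebra_simps scaleR_2)
  moreover have "star (1 - y) = 1 - y" "a * (1 - y) = (1 - y) * a"
    using y(1) by (simp_all add: S_def star_diff star_one algebra_simps)
  ultimately show ?thesis using that by blast
qed

text \<open>\<open>h + i k\<close> with \<open>k\<^sup>2 = 1 - h\<^sup>2\<close> is unitary, so its imaginary part \<open>k\<close> is a contraction.\<close>

lemma norm_one_minus_square_le:
  fixes h :: "'a::unital_cstar_algebra"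
  assumes h: "star h = h" "norm h \<le> 1"
  shows "norm (1 - h * h) \<le> 1"
proof -
  have strict: "norm (1 - h * h) \<le> 1" if h: "star h = h" "norm h < 1" for h :: 'a
  proof -
    have "norm (h * h) < 1"
      using norm_selfadjoint_square[OF h(1)] h(2) by (simp add: power_less_one_iff)
    then obtain k where k: "star k = k" "h * k = k * h" "k * k = 1 - h * h"
      using square_root_one_minus[of "h * h" h] h(1) by (auto simp: star_mult mult.assoc)
    let ?u = "h + \<i> *\<^sub>C k"
    have "(norm ?u)\<^sup>2 = 1" using norm_cartesian_commuting[OF h(1) k(1,2)] k(3) by simp
    then have u: "norm ?u = 1" by (simp add: power2_eq_1_iff) (smt (verit) norm_ge_zero)
    have "star ?u = h - \<i> *\<^sub>C k" by (simp add: star_add star_scaleC h k scaleC_minus_left)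
    then have "?u - star ?u = 2 *\<^sub>R (\<i> *\<^sub>C k)" by (simp add: scaleR_2)
    then have "2 * norm k = norm (?u - star ?u)" by (simp add: norm_scaleC)
    also have "\<dots> \<le> 2" using norm_triangle_ineq4[of ?u "star ?u"] u by simp
    finally have "norm k \<le> 1" by simp
    then have "norm (k * k) \<le> 1" using norm_selfadjoint_square[OF k(1)] by (simp add: power_le_one)
    then show ?thesis by (simp add: k(3))
  qed
  \<comment> \<open>The boundary case follows by applying the strict case to
    \<open>t *\<^sub>R h\<close> and letting \<open>t\<close> tend to 1 from below.\<close>
  have "norm (1 - t *\<^sub>R h * t *\<^sub>R h) \<le> 1" if "t \<in> {0<..<1}" for t :: real
  proof (rule strict)
    show "norm (t *\<^sub>R h) < 1" using that h(2)
      by (smt (verit) greaterThanLessThan_iff mult_left_le norm_scaleR)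
  qed (simp add: star_scaleR h)
  then have "eventually (\<lambda>t. norm (1 - t *\<^sub>R h * t *\<^sub>R h) \<le> 1) (at_left (1::real))"
    using eventually_at_left_real[of 0 1] by (auto elim: eventually_mono)
  moreover have "((\<lambda>t. norm (1 - t *\<^sub>R h * t *\<^sub>R h)) \<longlongrightarrow> norm (1 - 1 *\<^sub>R h * 1 *\<^sub>R h)) (at_left (1::real))"
    by (intro tendsto_intros)
  ultimately show ?thesis
    using tendsto_upperbound[of _ "norm (1 - h * h)" "at_left (1::real)" 1] by simp
qed

text \<open>This is a degenerate Cauchy-Schwarz inequality: the value at the square of
  \<open>w + t *\<^sub>R h\<close> is affine in \<open>t\<close> and nonnegative for every real
  \<open>t\<close>, so its slope is zero.\<close>

lemma state_orthogonal:
  fixes h w :: "'a::unital_cstar_algebra"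
  assumes \<phi>: "\<phi> \<in> states" and hw: "star h = h" "star w = w" "h * w = w * h"
    and zero: "Re (\<phi> (h * h)) = 0"
  shows "Re (\<phi> (h * w)) = 0"
proof (rule ccontr)
  define s b where "s = Re (\<phi> (w * w))" and "b = Re (\<phi> (h * w))"
  assume "Re (\<phi> (h * w)) \<noteq> 0"
  then have "b \<noteq> 0" by (simp add: b_def)
  have nonneg: "0 \<le> s + t * (2 * b)" for t
  proof -
    let ?v = "w + t *\<^sub>R h"
    have "?v * ?v = w * w + (2 * t) *\<^sub>R (h * w) + (t * t) *\<^sub>R (h * h)"
      using hw(3) by (simp add: algebra_simps flip: scaleR_2)
    then have "Re (\<phi> (?v * ?v)) = s + t * (2 * b)"
      using zero by (simp add: state_add[OF \<phi>] state_scaleR[OF \<phi>] s_def b_def)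
    moreover have "star ?v = ?v" by (simp add: star_add star_scaleR hw)
    ultimately show ?thesis using state_square_nonneg[OF \<phi>] by metis
  qed
  show False using nonneg[of "- (s + 1) / (2 * b)"] \<open>b \<noteq> 0\<close> by simp
qed

text \<open>A functional norming \<open>a\<^sup>2\<close> yields a state concentrated on the spectral values \<open>1\<close> and
  \<open>-1\<close> of \<open>a\<close>. Either \<open>-1\<close> carries all the mass, or the powers of \<open>1 + a\<close> grow like those
  of 2.\<close>

lemma norm_one_plus_or_state:
  fixes a :: "'a::unital_cstar_algebra"
  assumes a: "star a = a" "norm a = 1"
  shows "norm (1 + a) = 2 \<or> (\<exists>\<phi>\<in>states. cmod (\<phi> a) = 1)"
proof -
  define b where "b = a * a"
  have b: "star b = b" "norm b = 1" "a * b = b * a"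
    using norm_selfadjoint_square[OF a(1)] a by (simp_all add: b_def star_mult mult.assoc)
  have bb: "norm (b * b) = 1" using norm_selfadjoint_square[OF b(1)] b(2) by simp
  obtain F :: "'a \<Rightarrow> complex" where F_add: "\<And>x y. F (x + y) = F x + F y"
    and F_scaleC: "\<And>c x. F (c *\<^sub>C x) = c * F x" and F_le: "\<And>x. cmod (F x) \<le> norm x"
    and Fb: "F b = 1"
    using norming_functional[of b] b(2) by (metis of_real_1)
  \<comment> \<open>Multiplying by \<open>b\<close> moves the norming point of \<open>F\<close> to
    the unit, since \<open>\<phi> 1 = F b = 1\<close>.\<close>
  define \<phi> where "\<phi> z = F (b * z)" for z
  have \<phi>: "\<phi> \<in> states"
  proof (rule statesI)
    show "cmod (\<phi> x) \<le> norm x" for x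
      unfolding \<phi>_def using F_le[of "b * x"] norm_mult_ineq[of b x] b(2) by simp
  qed (simp_all add: \<phi>_def F_add F_scaleC Fb distrib_left mult_scaleC_right)
  have le: "\<bar>Re (\<phi> x)\<bar> \<le> norm x" for x
    using abs_Re_le_cmod state_norm_le[OF \<phi>] order_trans by blast
  \<comment> \<open>The contraction bound is used twice, for \<open>a\<close> and then for
    \<open>1 - b\<close>. Through \<open>F\<close> it bounds the state at \<open>2 - b\<close> by 1,
    which forces its value at \<open>b\<close> up to 1.\<close>
  have "norm (1 - (1 - b) * (1 - b)) \<le> 1"
    using norm_one_minus_square_le[of "1 - b"] norm_one_minus_square_le[of a] a b
    by (simp add: star_diff star_one b_def)
  moreover have "1 - (1 - b) * (1 - b) = b * (2 *\<^sub>R 1 - b)"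
    by (simp add: algebra_simps) (simp add: scaleR_2)
  ultimately have "cmod (\<phi> (2 *\<^sub>R 1 - b)) \<le> 1"
    unfolding \<phi>_def using F_le[of "b * (2 *\<^sub>R 1 - b)"] by simp
  then have "\<bar>Re (\<phi> (2 *\<^sub>R 1 - b))\<bar> \<le> 1" using abs_Re_le_cmod order_trans by blast
  then have "Re (\<phi> b) \<ge> 1"
    by (simp add: state_diff[OF \<phi>] state_scaleR[OF \<phi>] state_one[OF \<phi>])
  with le[of b] b(2) have \<phi>b: "Re (\<phi> b) = 1" by simp
  then have \<phi>bb: "Re (\<phi> (b * b)) = 1"
    using state_kadison[OF \<phi> b(1)] le[of "b * b"] bb by simp
  have "(1 - b) * (1 - b) = 1 - 2 *\<^sub>R b + b * b" by (simp add: algebra_simps scaleR_2)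
  then have zero: "Re (\<phi> ((1 - b) * (1 - b))) = 0"
    by (simp add: state_diff[OF \<phi>] state_add[OF \<phi>] state_scaleR[OF \<phi>] state_one[OF \<phi>] \<phi>b \<phi>bb)
  define m where "m = Re (\<phi> a)"
  \<comment> \<open>The square of \<open>1 + a\<close> is \<open>2 *\<^sub>R (1 + a)\<close> minus
    \<open>1 - b\<close>. The state does not see the correction by \<open>state_orthogonal\<close>,
    so each further factor doubles the value.\<close>
  have power: "Re (\<phi> ((1 + a) ^ Suc n)) = 2 ^ n * (1 + m)" for n
  proof (induction n)
    case 0
    show ?case by (simp add: state_add[OF \<phi>] state_one[OF \<phi>] m_def)
  next
    case (Suc n)
    have comm: "(1 - b) * (1 + a) ^ n = (1 + a) ^ n * (1 - b)"
      by (rule power_commuting_commutes[symmetric]) (use b(3) in \<open>simp add: algebra_simps\<close>)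
    have "Re (\<phi> ((1 - b) * (1 + a) ^ n)) = 0"
      by (rule state_orthogonal[OF \<phi> _ _ comm zero])
        (simp_all add: star_diff star_one star_power star_add a b)
    moreover have "(1 + a) * (1 + a) = 2 *\<^sub>R (1 + a) - (1 - b)"
      by (simp add: b_def algebra_simps scaleR_2)
    then have "(1 + a) ^ Suc (Suc n) = 2 *\<^sub>R (1 + a) ^ Suc n - (1 - b) * (1 + a) ^ n"
      by (simp add: left_diff_distrib flip: mult.assoc)
    ultimately show ?case
      by (simp add: state_diff[OF \<phi>] state_scaleR[OF \<phi>] Suc.IH del: power_Suc) simp
  qed
  have \<alpha>: "norm (1 + a) \<le> 2" using norm_triangle_ineq[of 1 a] a(2) by simp
  show ?thesis
  proof (cases "norm (1 + a) = 2")
    case False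
    define \<theta> where "\<theta> = norm (1 + a) / 2"
    have \<theta>: "0 \<le> \<theta>" "\<theta> < 1" using False \<alpha> by (auto simp: \<theta>_def)
    \<comment> \<open>If \<open>norm (1 + a)\<close> is below 2, the doubling outgrows the norms of
      the powers unless \<open>1 + m \<le> 0\<close>. Then \<open>m \<le> -1\<close>, and
      \<open>norm a = 1\<close> leaves modulus exactly 1.\<close>
    have "1 + m \<le> 2 * \<theta> * \<theta> ^ n" for n
    proof -
      have "2 ^ n * (1 + m) \<le> norm (1 + a) ^ Suc n"
        using le[of "(1 + a) ^ Suc n"] norm_power_ineq[of "1 + a" "Suc n"] power[of n] by linarith
      also have "\<dots> = 2 ^ n * (2 * \<theta> * \<theta> ^ n)" by (simp add: \<theta>_def power_divide)
      finally show ?thesis by simp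
    qed
    moreover have "(\<lambda>n. 2 * \<theta> * \<theta> ^ n) \<longlonglongrightarrow> 2 * \<theta> * 0"
      using \<theta> by (intro tendsto_mult_left LIMSEQ_power_zero) auto
    ultimately have "1 + m \<le> 0"
      by (intro LIMSEQ_le_const[of "\<lambda>n. 2 * \<theta> * \<theta> ^ n"]) auto
    then have "cmod (\<phi> a) = 1"
      using abs_Re_le_cmod[of "\<phi> a"] state_norm_le[OF \<phi>, of a] a(2) by (simp add: m_def)
    then show ?thesis using \<phi> by blast
  qed simp
qed

text \<open>After scaling to norm 1, suppose \<open>1 + a\<close> has norm 2. A functional norming
  it has modulus at most 1 at both \<open>1\<close> and \<open>a\<close>, with values summing to 2,
  so it equals 1 at the unit and is a state norming \<open>a\<close>. The other case is
  \<open>norm_one_plus_or_state\<close>.\<close>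

lemma norming_state:
  fixes a :: "'a::unital_cstar_algebra"
  assumes a: "star a = a"
  obtains \<phi> where "\<phi> \<in> states" "cmod (\<phi> a) = norm a"
proof -
  have unit: "\<exists>\<phi>\<in>states. cmod (\<phi> a) = 1" if a: "star a = a" "norm a = 1" for a :: 'a
  proof (cases "norm (1 + a) = 2")
    case True
    obtain F :: "'a \<Rightarrow> complex" where F_add: "\<And>x y. F (x + y) = F x + F y"
      and F_scaleC: "\<And>c x. F (c *\<^sub>C x) = c * F x" and F_le: "\<And>x. cmod (F x) \<le> norm x"
      and F2: "F (1 + a) = of_real (norm (1 + a))"
      using norming_functional[of "1 + a"] by metis
    have "cmod (F 1) \<le> 1" "cmod (F a) \<le> 1" using F_le[of 1] F_le[of a] a(2) by auto
    moreover have "Re (F 1) + Re (F a) = 2" using F2 True by (simp add: F_add complex_eq_iff)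
    ultimately have Re1: "Re (F 1) = 1" "Re (F a) = 1"
      using complex_Re_le_cmod[of "F 1"] complex_Re_le_cmod[of "F a"] by linarith+
    have "cmod (F 1) = 1" "cmod (F a) = 1"
      using Re1 \<open>cmod (F 1) \<le> 1\<close> \<open>cmod (F a) \<le> 1\<close> complex_Re_le_cmod[of "F 1"]
        complex_Re_le_cmod[of "F a"] by linarith+
    moreover from this Re1 have "F 1 = 1"
      using cmod_power2[of "F 1"] by (simp add: complex_eq_iff)
    ultimately show ?thesis using statesI[of F, OF F_add F_scaleC F_le] by blast
  next
    case False
    then show ?thesis using norm_one_plus_or_state[OF a] by blast
  qed
  show ?thesis
  proof (cases "a = 0")
    case True
    obtain \<phi> where \<phi>: "\<phi> \<in> (states :: ('a \<Rightarrow> complex) set)"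
      using unit[of 1] by (auto simp: star_one)
    then show ?thesis using that[OF \<phi>] state_norm_le[OF \<phi>, of 0] True by simp
  next
    case False
    then obtain \<phi> where \<phi>: "\<phi> \<in> states" "cmod (\<phi> ((1 / norm a) *\<^sub>R a)) = 1"
      using unit[of "(1 / norm a) *\<^sub>R a"] a by (auto simp: star_scaleR)
    then show ?thesis using that False by (simp add: state_scaleR[OF \<phi>(1)] field_simps)
  qed
qed

section \<open>Numerical radius\<close>

lemma numerical_radius_ge:
  assumes "\<phi> \<in> states"
  shows "cmod (\<phi> x) \<le> numerical_radius x"
  unfolding numerical_radius_def
  by (rule cSUP_upper[OF assms]) (auto intro!: bdd_aboveI2[where M = "norm x"] state_norm_le)

lemma numerical_radius_le:
  assumes "\<And>\<phi>. \<phi> \<in> states \<Longrightarrow> cmod (\<phi> x) \<le> c"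
  shows "numerical_radius x \<le> c"
  unfolding numerical_radius_def
proof (rule cSUP_least)
  show "(states :: ('a \<Rightarrow> complex) set) \<noteq> {}"
    using norming_state[of 1] by (auto simp: star_one)
qed (use assms in auto)

lemma norm_square_le_norm_sum:
  fixes x :: "'a::unital_cstar_algebra"
  shows "(norm x)\<^sup>2 \<le> norm (star x * x + x * star x)"
proof -
  have sa: "star (star x * x) = star x * x" by (simp add: star_mult star_star)
  then obtain \<phi> where \<phi>: "\<phi> \<in> states" "cmod (\<phi> (star x * x)) = norm (star x * x)"
    by (rule norming_state)
  have "0 \<le> Re (\<phi> (star x * x))" by (rule state_star_mult_nonneg[OF \<phi>(1)])
  then have "Re (\<phi> (star x * x)) = (norm x)\<^sup>2"
    using \<phi>(2) state_selfadjoint_real[OF \<phi>(1) sa]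
    by (metis abs_of_nonneg norm_of_real norm_star_mult_self)
  moreover have "0 \<le> Re (\<phi> (x * star x))"
    using state_star_mult_nonneg[OF \<phi>(1), of "star x"] by (simp add: star_star)
  ultimately have "(norm x)\<^sup>2 \<le> Re (\<phi> (star x * x + x * star x))"
    by (simp add: state_add[OF \<phi>(1)])
  also have "\<dots> \<le> norm (star x * x + x * star x)"
    using complex_Re_le_cmod state_norm_le[OF \<phi>(1)] order_trans by blast
  finally show ?thesis .
qed

lemma norm_sum_le: "norm (star x * x + x * star x) \<le> 2 * (norm (x::'a::unital_cstar_algebra))\<^sup>2"
  using norm_triangle_ineq[of "star x * x" "x * star x"] norm_star_mult_self[of x]
    norm_star_mult_self[of "star x"] by (simp add: star_star)

lemma norm_sum_le_numerical_radius:
  fixes x :: "'a::unital_cstar_algebra"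
  shows "norm (star x * x + x * star x) \<le> (2 * numerical_radius x)\<^sup>2"
proof -
  obtain p q where pq: "star p = p" "star q = q" "x = p + \<i> *\<^sub>C q"
    by (rule cartesian_decomposition)
  have val: "\<phi> x = Complex (Re (\<phi> p)) (Re (\<phi> q))" if "\<phi> \<in> states" for \<phi>
    using state_selfadjoint_real[OF that pq(1)] state_selfadjoint_real[OF that pq(2)]
    by (simp add: pq(3) state_add[OF that] state_scaleC[OF that] complex_eq_iff)
  \<comment> \<open>Selfadjoint \<open>h\<close> are normed by states. The bound applies to
    \<open>p\<close> and \<open>q\<close> because a state maps them to the real and imaginary parts
    of its value at \<open>x\<close>.\<close>
  have le: "norm h \<le> numerical_radius x"
    if "star h = h" and h: "\<And>\<phi>. \<phi> \<in> states \<Longrightarrow> \<bar>Re (\<phi> h)\<bar> \<le> cmod (\<phi> x)" for h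
  proof -
    obtain \<phi> where \<phi>: "\<phi> \<in> states" "cmod (\<phi> h) = norm h"
      using norming_state[OF \<open>star h = h\<close>] .
    have "norm h = \<bar>Re (\<phi> h)\<bar>"
      using \<phi>(2) state_selfadjoint_real[OF \<phi>(1) \<open>star h = h\<close>] by (metis norm_of_real)
    then show ?thesis using h[OF \<phi>(1)] numerical_radius_ge[OF \<phi>(1), of x] by linarith
  qed
  have "norm p \<le> numerical_radius x"
    by (rule le[OF pq(1)]) (use val abs_Re_le_cmod in \<open>metis complex.sel(1)\<close>)
  moreover have "norm q \<le> numerical_radius x"
    by (rule le[OF pq(2)]) (use val abs_Im_le_cmod in \<open>metis complex.sel(2)\<close>)
  ultimately have "(norm p)\<^sup>2 + (norm q)\<^sup>2 \<le> (numerical_radius x)\<^sup>2 + (numerical_radius x)\<^sup>2"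
    by (intro add_mono power_mono) auto
  then show ?thesis
    using norm_triangle_ineq[of "p * p" "q * q"] norm_selfadjoint_square[OF pq(1)]
      norm_selfadjoint_square[OF pq(2)]
    unfolding cartesian_sum[OF pq] by (simp add: power_mult_distrib)
qed

text \<open>The Kadison inequality for \<open>p\<close> and \<open>q\<close> bounds the squared
  modulus of the state's value at \<open>x\<close> by its value at \<open>p * p + q * q\<close>,
  which is half of the symmetrized product.\<close>

lemma numerical_radius_le_norm_sum:
  fixes x :: "'a::unital_cstar_algebra"
  shows "numerical_radius x \<le> sqrt (norm (star x * x + x * star x) / 2)"
proof (rule numerical_radius_le)
  fix \<phi> :: "'a \<Rightarrow> complex" assume \<phi>: "\<phi> \<in> states"
  obtain p q where pq: "star p = p" "star q = q" "x = p + \<i> *\<^sub>C q"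
    by (rule cartesian_decomposition)
  have "(cmod (\<phi> x))\<^sup>2 = (Re (\<phi> p))\<^sup>2 + (Re (\<phi> q))\<^sup>2"
    using state_selfadjoint_real[OF \<phi> pq(1)] state_selfadjoint_real[OF \<phi> pq(2)]
    by (simp add: pq(3) state_add[OF \<phi>] state_scaleC[OF \<phi>] cmod_power2 complex_eq_iff)
  also have "\<dots> \<le> Re (\<phi> (p * p)) + Re (\<phi> (q * q))"
    by (intro add_mono state_kadison[OF \<phi>] pq)
  also have "\<dots> = Re (\<phi> (p * p + q * q))" by (simp add: state_add[OF \<phi>])
  also have "\<dots> \<le> norm (p * p + q * q)"
    using complex_Re_le_cmod state_norm_le[OF \<phi>] order_trans by blast
  also have "\<dots> = norm (star x * x + x * star x) / 2"
    unfolding cartesian_sum[OF pq] by simp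
  finally show "cmod (\<phi> x) \<le> sqrt (norm (star x * x + x * star x) / 2)"
    by (rule real_le_rsqrt)
qed

theorem theorem2p9:
  fixes x :: "'a::unital_cstar_algebra"
  shows "(1 / 2 * norm x \<le> 1 / 2 * sqrt (norm (star x * x + x * star x))
        \<and> 1 / 2 * sqrt (norm (star x * x + x * star x)) \<le> numerical_radius x)
       \<and> (numerical_radius x \<le> 1 / sqrt 2 * sqrt (norm (star x * x + x * star x))
        \<and> 1 / sqrt 2 * sqrt (norm (star x * x + x * star x)) \<le> norm x)"
proof (intro conjI)
  let ?S = "norm (star x * x + x * star x)"
  show "1 / 2 * norm x \<le> 1 / 2 * sqrt ?S"
    using real_le_rsqrt[OF norm_square_le_norm_sum[of x]] by simp
  have "0 \<le> numerical_radius x"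
  proof -
    obtain \<phi> where "\<phi> \<in> (states :: ('a \<Rightarrow> complex) set)"
      using norming_state[of 1] by (auto simp: star_one)
    then show ?thesis using numerical_radius_ge[of \<phi> x] norm_ge_zero[of "\<phi> x"] by linarith
  qed
  then show "1 / 2 * sqrt ?S \<le> numerical_radius x"
    using real_le_lsqrt[OF _ norm_sum_le_numerical_radius[of x]] by simp
  show "numerical_radius x \<le> 1 / sqrt 2 * sqrt ?S"
    using numerical_radius_le_norm_sum[of x] by (simp add: real_sqrt_divide)
  have "sqrt ?S \<le> sqrt 2 * norm x"
    using norm_sum_le[of x] by (intro real_le_lsqrt) (simp_all add: power_mult_distrib)
  then show "1 / sqrt 2 * sqrt ?S \<le> norm x" by (simp add: field_simps)
qed

end
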